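(* Let $\mathbb{K}\in\{\mathbb{R},\mathbb{C}\}$ and let all constants below be taken with respect to $\mathbb{K}$. Then: (1) $C_{p_1,p_2}\le\sqrt{8/5}$ for all $p_1,p_2\in[2,\infty]$; (2) $C_{p,p}\le\sqrt{8/5}$ for all $p\in[1,\infty]$; (3) $C_{p_1,p_2,n_1,n_2}\le\sqrt{8/5}$ whenever $p_1,p_2\in[1,\infty]$ and $n_1,n_2$ are positive integers satisfying one of the following: (i) $1\le p_1<2\le p_2$ and $n_1\le n_2$; (ii) $1\le p_2<2\le p_1$ and $n_1\ge n_2$; (iii) $1\le p_1\le p_2\le 2$ and $n_1\le n_2$; (iv) $1\le p_2\le p_1\le 2$ and $n_1\ge n_2$.
   Context: $\ell_p^n$ denotes $\mathbb{K}^n$ with the $\ell_p$-norm. For $p\in[1,\infty]$, $p^*$ is the conjugate exponent, $1/p+1/p^*=1$, with the convention $1/\infty=0$. A bilinear form $A\colon \ell_{p_1}^{n_1}\times\ell_{p_2}^{n_2}\to\mathbb{K}$ "with coefficients $\pm1$" is one of the form $A(x,y)=\sum_{i=1}^{n_1}\sum_{j=1}^{n_2}a_{ij}x_iy_j$ with all $a_{ij}\in\{-1,1\}$; its norm is $\|A\|=\sup\{|A(x,y)|:\|x\|_{p_1}\le1,\|y\|_{p_2}\le1\}$. For $p_1,p_2\in[1,\infty]$ and positive integers $n_1,n_2$, $C_{p_1,p_2,n_1,n_2}$ is the smallest constant $C\ge0$ such that there exists a bilinear form $A\colon\ell_{p_1}^{n_1}\times\ell_{p_2}^{n_2}\to\mathbb{K}$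 with coefficients $\pm1$ satisfying $\|A\|\le C\max\{n_1^{1/p_1^*}n_2^{\max\{1/2-1/p_2,0\}},\,n_2^{1/p_2^*}n_1^{\max\{1/2-1/p_1,0\}}\}$, and $C_{p_1,p_2}:=\sup\{C_{p_1,p_2,n_1,n_2}:n_1,n_2\in\mathbb{N}\}$. *)

theory Defs
  imports Complex_Main "HOL-Library.Extended_Real" "HOL-Library.FuncSet"
begin

text \<open>
  The scalar field is a set \<open>K\<close> of complex numbers, either \<open>\<real>\<close> or \<open>UNIV\<close>; in this way
  both fields, with their absolute values, are covered by one family of definitions.
  Exponents are extended reals in \<open>[1,\<infinity>]\<close>; note that \<open>1 / \<infinity> = 0\<close> and \<open>1 / 0 = \<infinity>\<close> in
  \<^typ>\<open>ereal\<close>. The space \<open>K\<^sup>n\<close> is \<open>{..<n} \<rightarrow>\<^sub>E K\<close>, with indices starting at 0.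
\<close>

definition conj_exp :: "ereal \<Rightarrow> ereal" where
  "conj_exp p = 1 / (1 - 1 / p)"

definition recip :: "ereal \<Rightarrow> real" where
  "recip p = real_of_ereal (1 / p)"

definition lp_norm :: "ereal \<Rightarrow> nat \<Rightarrow> (nat \<Rightarrow> complex) \<Rightarrow> real" where
  "lp_norm p n x =
     (if p = \<infinity> then Max ((\<lambda>i. norm (x i)) ` {..<n})
      else (\<Sum>i<n. norm (x i) powr real_of_ereal p) powr (1 / real_of_ereal p))"

definition lp_ball :: "complex set \<Rightarrow> ereal \<Rightarrow> nat \<Rightarrow> (nat \<Rightarrow> complex) set" where
  "lp_ball K p n = {x \<in> {..<n} \<rightarrow>\<^sub>E K. lp_norm p n x \<le> 1}"

type_synonym form = "(nat \<Rightarrow> complex) \<Rightarrow> (nat \<Rightarrow> complex) \<Rightarrow> complex"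

definition sign_forms :: "nat \<Rightarrow> nat \<Rightarrow> form set" where
  "sign_forms n1 n2 =
     {A. \<exists>a :: nat \<Rightarrow> nat \<Rightarrow> complex. (\<forall>i<n1. \<forall>j<n2. a i j \<in> {-1, 1}) \<and>
         A = (\<lambda>x y. \<Sum>i<n1. \<Sum>j<n2. a i j * x i * y j)}"

definition form_norm ::
    "complex set \<Rightarrow> ereal \<Rightarrow> ereal \<Rightarrow> nat \<Rightarrow> nat \<Rightarrow> form \<Rightarrow> real" where
  "form_norm K p1 p2 n1 n2 A =
     (SUP (x, y) \<in> lp_ball K p1 n1 \<times> lp_ball K p2 n2. norm (A x y))"

definition growth :: "ereal \<Rightarrow> ereal \<Rightarrow> nat \<Rightarrow> nat \<Rightarrow> real" where
  "growth p1 p2 n1 n2 =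
     max (real n1 powr recip (conj_exp p1) * real n2 powr max (1/2 - recip p2) 0)
         (real n2 powr recip (conj_exp p2) * real n1 powr max (1/2 - recip p1) 0)"

definition admissible ::
    "complex set \<Rightarrow> ereal \<Rightarrow> ereal \<Rightarrow> nat \<Rightarrow> nat \<Rightarrow> real \<Rightarrow> bool" where
  "admissible K p1 p2 n1 n2 C \<longleftrightarrow>
     0 \<le> C \<and> (\<exists>A \<in> sign_forms n1 n2. form_norm K p1 p2 n1 n2 A \<le> C * growth p1 p2 n1 n2)"

text \<open>The minimum exists, see \<open>admissible_best_const\<close> below.\<close>

definition best_const :: "complex set \<Rightarrow> ereal \<Rightarrow> ereal \<Rightarrow> nat \<Rightarrow> nat \<Rightarrow> real" where
  "best_const K p1 p2 n1 n2 = (LEAST C. admissible K p1 p2 n1 n2 C)"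

text \<open>The supremum is taken in \<^typ>\<open>ereal\<close>, so no finiteness is presupposed.\<close>

definition sup_const :: "complex set \<Rightarrow> ereal \<Rightarrow> ereal \<Rightarrow> ereal" where
  "sup_const K p1 p2 = (SUP (n1, n2) \<in> {1..} \<times> {1..}. ereal (best_const K p1 p2 n1 n2))"

lemma conj_exp_iff:
  assumes "1 \<le> p" "1 \<le> q"
  shows "1 / p + 1 / q = 1 \<longleftrightarrow> q = conj_exp p"
proof (cases p)
  case (real r)
  then have r: "r \<ge> 1" using assms by (simp add: one_ereal_def)
  show ?thesis
  proof (cases q)
    case (real s)
    then have s: "s \<ge> 1" using assms by (simp add: one_ereal_def)
    have "1 / p + 1 / q = 1 \<longleftrightarrow> 1 / r + 1 / s = 1"
      using r s \<open>p = ereal r\<close> real by (simp add: one_ereal_def)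
    moreover have "q = conj_exp p \<longleftrightarrow> r \<noteq> 1 \<and> s = 1 / (1 - 1 / r)"
      using r s \<open>p = ereal r\<close> real by (auto simp: one_ereal_def conj_exp_def divide_ereal_def inverse_eq_divide)
    moreover have "1 / r + 1 / s = 1 \<longleftrightarrow> r \<noteq> 1 \<and> s = 1 / (1 - 1 / r)"
    proof (cases "r = 1")
      case False
      then have "1 - 1 / r \<noteq> 0" using r by (simp add: field_simps)
      have "1 / r + 1 / s = 1 \<longleftrightarrow> 1 / s = 1 - 1 / r" by auto
      also have "\<dots> \<longleftrightarrow> s = 1 / (1 - 1 / r)"
        using s \<open>1 - 1 / r \<noteq> 0\<close> by (metis div_by_1 divide_divide_eq_right mult_1)
      finally show ?thesis using False by simp
    qed (use s in auto)
    ultimately show ?thesis by simp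
  next
    case PInf
    then show ?thesis using r real
      by (auto simp: one_ereal_def conj_exp_def divide_ereal_def zero_ereal_def)
  qed (use assms in auto)
next
  case PInf
  then show ?thesis using assms
    by (cases q) (auto simp: one_ereal_def conj_exp_def divide_ereal_def field_simps)
qed (use assms in auto)

lemma norm_le_lp_norm:
  assumes "1 \<le> p" "i < n"
  shows "norm (x i) \<le> lp_norm p n x"
proof (cases p)
  case (real r)
  then have r: "r \<ge> 1" using assms by (simp add: one_ereal_def)
  have "norm (x i) powr r \<le> (\<Sum>i<n. norm (x i) powr r)"
    using assms by (intro member_le_sum) auto
  then have "(norm (x i) powr r) powr (1 / r) \<le> (\<Sum>i<n. norm (x i) powr r) powr (1 / r)"
    using r by (intro powr_mono2) auto
  then show ?thesis using r real by (simp add: lp_norm_def powr_powr)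
next
  case PInf
  then show ?thesis using assms by (auto simp: lp_norm_def intro!: Max_ge)
qed (use assms in auto)

lemma bdd_above_form:
  assumes "1 \<le> p1" "1 \<le> p2" "A \<in> sign_forms n1 n2"
  shows "bdd_above ((\<lambda>(x, y). norm (A x y)) ` (lp_ball K p1 n1 \<times> lp_ball K p2 n2))"
proof -
  obtain a where a: "\<And>i j. i < n1 \<Longrightarrow> j < n2 \<Longrightarrow> a i j \<in> {-1, 1 :: complex}"
    and A: "A = (\<lambda>x y. \<Sum>i<n1. \<Sum>j<n2. a i j * x i * y j)"
    using assms(3) unfolding sign_forms_def by blast
  have "norm (A x y) \<le> (\<Sum>i<n1. \<Sum>j<n2. 1 :: real)"
    if "x \<in> lp_ball K p1 n1" "y \<in> lp_ball K p2 n2" for x y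
    unfolding A
  proof (intro sum_norm_le)
    fix i j assume ij: "i \<in> {..<n1}" "j \<in> {..<n2}"
    have "norm (a i j) = 1" using a[of i j] ij by auto
    moreover have "norm (x i) \<le> 1" "norm (y j) \<le> 1"
      using that ij norm_le_lp_norm[OF assms(1), of i n1 x]
        norm_le_lp_norm[OF assms(2), of j n2 y] by (auto simp: lp_ball_def)
    ultimately show "norm (a i j * x i * y j) \<le> 1"
      by (simp add: norm_mult mult_le_one)
  qed
  then show ?thesis by (intro bdd_aboveI2) auto
qed

lemma finite_sign_forms: "finite (sign_forms n1 n2)"
proof -
  let ?F = "\<lambda>(a :: nat \<Rightarrow> nat \<Rightarrow> complex) x y. \<Sum>i<n1. \<Sum>j<n2. a i j * x i * y j"
  let ?S = "{..<n1} \<rightarrow>\<^sub>E ({..<n2} \<rightarrow>\<^sub>E {-1, 1 :: complex})"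
  have "sign_forms n1 n2 \<subseteq> ?F ` ?S"
  proof
    fix A assume "A \<in> sign_forms n1 n2"
    then obtain a where a: "\<forall>i<n1. \<forall>j<n2. a i j \<in> {-1, 1 :: complex}" and A: "A = ?F a"
      unfolding sign_forms_def by blast
    let ?b = "\<lambda>i\<in>{..<n1}. \<lambda>j\<in>{..<n2}. a i j"
    have "A = ?F ?b" unfolding A by (intro ext sum.cong refl) auto
    moreover have "?b \<in> ?S" using a by (auto intro!: restrict_PiE)
    ultimately show "A \<in> ?F ` ?S" by blast
  qed
  moreover have "finite ?S" by (intro finite_PiE) auto
  ultimately show ?thesis by (meson finite_imageI finite_subset)
qed

lemma sign_forms_nonempty: "sign_forms n1 n2 \<noteq> {}"
proof -
  have "(\<lambda>x y. \<Sum>i<n1. \<Sum>j<n2. 1 * x i * y j) \<in> sign_forms n1 n2"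
    unfolding sign_forms_def by (intro CollectI exI[of _ "\<lambda>_ _. 1"]) auto
  then show ?thesis by blast
qed

lemma admissible_best_const:
  assumes "1 \<le> n1" "1 \<le> n2"
  shows "admissible K p1 p2 n1 n2 (best_const K p1 p2 n1 n2)"
    and "admissible K p1 p2 n1 n2 C \<Longrightarrow> best_const K p1 p2 n1 n2 \<le> C"
proof -
  let ?g = "growth p1 p2 n1 n2"
  let ?N = "form_norm K p1 p2 n1 n2"
  let ?m = "Min (?N ` sign_forms n1 n2)"
  have g: "?g > 0" using assms by (auto simp: growth_def less_max_iff_disj)
  have fin: "finite (?N ` sign_forms n1 n2)" "?N ` sign_forms n1 n2 \<noteq> {}"
    using finite_sign_forms sign_forms_nonempty by auto
  have eq: "admissible K p1 p2 n1 n2 C \<longleftrightarrow> max 0 (?m / ?g) \<le> C" for C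
  proof -
    have "(\<exists>A\<in>sign_forms n1 n2. ?N A \<le> C * ?g) \<longleftrightarrow> ?m \<le> C * ?g"
      using Min_le_iff[OF fin] by auto
    then show ?thesis using g by (simp add: admissible_def pos_divide_le_eq)
  qed
  have "best_const K p1 p2 n1 n2 = max 0 (?m / ?g)"
    unfolding best_const_def by (rule Least_equality) (simp_all only: eq order_refl)
  then show "admissible K p1 p2 n1 n2 (best_const K p1 p2 n1 n2)"
    "admissible K p1 p2 n1 n2 C \<Longrightarrow> best_const K p1 p2 n1 n2 \<le> C"
    by (simp_all only: eq order_refl)
qed

end

theory Submission
  imports Defs "HOL-Complex_Analysis.Conformal_Mappings"
begin

text \<open>
  Let \<open>n = max n\<^sub>1 n\<^sub>2\<close>. There is a Hadamard matrix of order \<open>N\<close> with \<open>n \<le> N \<le> 8 n / 5\<close>,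
  and the form is one of its \<open>n\<^sub>1 \<times> n\<^sub>2\<close> submatrices. Orthogonality of the rows gives the
  norm \<open>\<surd>N\<close> on \<open>\<ell>\<^sub>2 \<times> \<ell>\<^sub>2\<close>; with Hoelder's inequality for exponents above 2 and the
  inclusion into \<open>\<ell>\<^sub>2\<close> for exponents below 2, this settles (1), (3)(i) and (3)(ii). If both
  exponents are at most \<open>q \<le> 2\<close>, interpolating with the trivial norm 1 on
  \<open>\<ell>\<^sub>1 \<times> \<ell>\<^sub>1\<close> gives the norm \<open>N\<^bsup>1 - 1/q\<^esup>\<close>, where \<open>1 - 1/q \<le> 1/2\<close>, so passing from
  \<open>N\<close> to \<open>n\<close> costs at most \<open>\<surd>(8/5)\<close> again. Bounds over the complex numbers
  cover the real case.
\<close>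

section \<open>Hadamard matrices and the orders at hand\<close>

definition hadamard :: "nat \<Rightarrow> (nat \<Rightarrow> nat \<Rightarrow> int) \<Rightarrow> bool" where
  "hadamard N H \<longleftrightarrow> (\<forall>i<N. \<forall>j<N. H i j \<in> {-1, 1}) \<and>
     (\<forall>i<N. \<forall>i'<N. (\<Sum>j<N. H i j * H i' j) = (if i = i' then int N else 0))"

lemma hadamard_1: "hadamard 1 (\<lambda>_ _. 1)"
  by (simp add: hadamard_def)

text \<open>Paley's construction: \<open>1, 3, 4, 5, 9\<close> are the nonzero squares modulo 11.\<close>

definition paley12 :: "nat \<Rightarrow> nat \<Rightarrow> int" where
  "paley12 i j = (if i = 0 then 1 else if j = 0 then -1
     else if (j + 11 - i) mod 11 \<in> {0, 1, 3, 4, 5, 9} then 1 else -1)"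

lemma paley12_sign: "paley12 i j \<in> {-1, 1}"
  by (simp add: paley12_def)

lemma hadamard_12: "hadamard 12 paley12"
proof -
  \<comment> \<open>With integer entries and sums over lists, all 144 products of rows can be
    evaluated by rewriting.\<close>
  have "\<forall>i \<in> set [0..<12]. \<forall>i' \<in> set [0..<12].
      (\<Sum>j\<leftarrow>[0..<12]. paley12 i j * paley12 i' j) = (if i = i' then 12 else 0)"
    by code_simp
  then have "\<forall>i<12. \<forall>i'<12.
      (\<Sum>j<12. paley12 i j * paley12 i' j) = (if i = i' then int 12 else 0)"
    by (simp only: sum_list_distinct_conv_sum_set distinct_upt set_upt atLeast0LessThan
        Ball_def lessThan_iff of_nat_numeral)
  then show ?thesis
    unfolding hadamard_def using paley12_sign by blast
qed

text \<open>Sylvester's construction: the Kronecker product of \<open>H\<close> with the matrix of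
  rows (1, 1) and (1, -1). The half of an index is its position in \<open>H\<close>, the parity its
  position in the small factor.\<close>

lemma hadamard_double:
  assumes "hadamard N H"
  shows "hadamard (2 * N)
    (\<lambda>i j. (if odd i \<and> odd j then -1 else 1) * H (i div 2) (j div 2))" (is "hadamard _ ?H")
proof -
  have split: "(\<Sum>j<2 * N. f j) = (\<Sum>j<N. f (2 * j) + f (2 * j + 1))" for f :: "nat \<Rightarrow> int"
    by (induction N) simp_all
  have "(\<Sum>j<2 * N. ?H i j * ?H i' j) = (if i = i' then int (2 * N) else 0)"
    if "i < 2 * N" "i' < 2 * N" for i i'
  proof -
    have eq: "i = i' \<longleftrightarrow> odd i = odd i' \<and> i div 2 = i' div 2" by presburger
    let ?h = "\<lambda>j. H (i div 2) j * H (i' div 2) j"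
    \<comment> \<open>In each pair of columns the even one contributes sign 1 and the odd one sign 1
      or -1, according to whether the parities of \<open>i\<close> and \<open>i'\<close> agree; so
      the pair doubles or cancels.\<close>
    have "(\<Sum>j<2 * N. ?H i j * ?H i' j) = (\<Sum>j<N. (if odd i = odd i' then 2 else 0) * ?h j)"
      unfolding split by (intro sum.cong) auto
    also have "\<dots> = (if odd i = odd i' then 2 else 0) * (\<Sum>j<N. ?h j)"
      by (simp add: sum_distrib_left)
    also have "(\<Sum>j<N. ?h j) = (if i div 2 = i' div 2 then int N else 0)"
      using assms that by (simp add: hadamard_def less_mult_imp_div_less mult.commute)
    also have "(if odd i = odd i' then 2 else 0) * \<dots> = (if i = i' then int (2 * N) else 0)"
      using eq by simp
    finally show ?thesis .
  qed
  moreover have "?H i j \<in> {-1, 1}" if "i < 2 * N" "j < 2 * N" for i j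
  proof -
    have "i div 2 < N" "j div 2 < N" using that by auto
    then show ?thesis using assms unfolding hadamard_def by auto
  qed
  ultimately show ?thesis unfolding hadamard_def by blast
qed

lemma hadamard_double_power:
  assumes "hadamard N H"
  shows "\<exists>H'. hadamard (2 ^ k * N) H'"
proof (induction k)
  case (Suc k)
  then obtain H' where "hadamard (2 ^ k * N) H'" by blast
  from hadamard_double[OF this] show ?case by (auto simp: mult.assoc)
qed (use assms in auto)

text \<open>The orders \<open>2\<^sup>k\<close> and \<open>12 \<cdot> 2\<^sup>k\<close> leave no gap longer than the factor \<open>8/5\<close>,
  which is attained at \<open>n = 5\<close>.\<close>

lemma exists_hadamard:
  assumes "1 \<le> n"
  obtains N H where "hadamard N H" "n \<le> N" "5 * N \<le> 8 * n"
proof -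
  obtain k where k: "2 ^ k \<le> n" "n < 2 ^ Suc k"
    using ex_power_ivl1[of 2 n] assms by auto
  show ?thesis
  proof (cases "n = 2 ^ k \<or> 5 * 2 ^ Suc k \<le> 8 * n")
    case True
    then show ?thesis
      using hadamard_double_power[OF hadamard_1, of k] hadamard_double_power[OF hadamard_1, of "Suc k"]
        k that[of "2 ^ k"] that[of "2 ^ Suc k"] by auto
  next
    case False
    \<comment> \<open>Here 2^k < n < (5/4) 2^k, which no integer satisfies for k <= 2. For k = j + 3
      the order 12 * 2^j = (3/2) 2^k serves, since 5 * (3/2) 2^k < 8 * 2^k < 8 n.\<close>
    have "k \<ge> 3"
    proof (rule ccontr)
      assume "\<not> 3 \<le> k"
      then have "k = 0 \<or> k = 1 \<or> k = 2" by auto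
      then show False using False k by auto
    qed
    then obtain j where "k = j + 3" using le_Suc_ex by (metis add.commute)
    then show ?thesis
      using hadamard_double_power[OF hadamard_12, of j] False k that[of "2 ^ j * 12"]
      by (auto simp: power_add)
  qed
qed

section \<open>The bound on l_2 x l_2\<close>

text \<open>Expanding the squared column sums \<open>c j\<close> and using orthogonality of the rows
  leaves only the diagonal terms, so \<open>c\<close> has l_2 norm sqrt N times that of
  \<open>x\<close>. Cauchy-Schwarz against \<open>y\<close> finishes.\<close>

lemma hadamard_bilinear_L2:
  fixes x y :: "nat \<Rightarrow> complex"
  assumes H: "hadamard N H" and n: "m \<le> N" "n \<le> N"
  shows "norm (\<Sum>i<m. \<Sum>j<n. of_int (H i j) * x i * y j)
    \<le> sqrt (real N) * L2_set (\<lambda>i. norm (x i)) {..<m} * L2_set (\<lambda>j. norm (y j)) {..<n}"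
proof -
  define c where "c = (\<lambda>j. \<Sum>i<m. of_int (H i j) * x i)"
  have "complex_of_real (\<Sum>j<N. (norm (c j))\<^sup>2) = (\<Sum>j<N. c j * cnj (c j))"
    by (simp only: of_real_sum complex_norm_square)
  also have "\<dots> = (\<Sum>j<N. \<Sum>i<m. \<Sum>i'<m. x i * cnj (x i') * of_int (H i j * H i' j))"
    by (simp add: c_def sum_product mult_ac)
  also have "\<dots> = (\<Sum>i<m. \<Sum>j<N. \<Sum>i'<m. x i * cnj (x i') * of_int (H i j * H i' j))"
    by (rule sum.swap)
  also have "\<dots> = (\<Sum>i<m. \<Sum>i'<m. \<Sum>j<N. x i * cnj (x i') * of_int (H i j * H i' j))"
    by (intro sum.cong refl sum.swap)
  also have "\<dots> = (\<Sum>i<m. \<Sum>i'<m. x i * cnj (x i') * of_int (\<Sum>j<N. H i j * H i' j))"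
    by (simp add: sum_distrib_left)
  also have "\<dots> = (\<Sum>i<m. \<Sum>i'<m. if i = i' then x i * cnj (x i') * of_nat N else 0)"
  proof (intro sum.cong refl)
    fix i i' assume "i \<in> {..<m}" "i' \<in> {..<m}"
    then have "(\<Sum>j<N. H i j * H i' j) = (if i = i' then int N else 0)"
      using H n by (simp add: hadamard_def)
    then show "x i * cnj (x i') * of_int (\<Sum>j<N. H i j * H i' j) =
        (if i = i' then x i * cnj (x i') * of_nat N else 0)"
      by (simp del: of_int_sum)
  qed
  also have "\<dots> = complex_of_real (real N * (\<Sum>i<m. (norm (x i))\<^sup>2))"
    by (simp add: complex_norm_square[symmetric] sum_distrib_left mult_ac)
  finally have c: "(\<Sum>j<N. (norm (c j))\<^sup>2) = real N * (\<Sum>i<m. (norm (x i))\<^sup>2)"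
    unfolding of_real_eq_iff .
  have "(\<Sum>i<m. \<Sum>j<n. of_int (H i j) * x i * y j) = (\<Sum>j<n. c j * y j)"
    unfolding c_def sum_distrib_right by (rule sum.swap)
  then have "norm (\<Sum>i<m. \<Sum>j<n. of_int (H i j) * x i * y j) \<le> (\<Sum>j<n. \<bar>norm (c j)\<bar> * \<bar>norm (y j)\<bar>)"
    by (simp add: sum_norm_le norm_mult)
  also have "\<dots> \<le> L2_set (\<lambda>j. norm (c j)) {..<n} * L2_set (\<lambda>j. norm (y j)) {..<n}"
    by (rule L2_set_mult_ineq)
  \<comment> \<open>Orthogonality concerns full rows, so the sum over the first \<open>n\<close>
    columns is enlarged to all \<open>N\<close>.\<close>
  also have "L2_set (\<lambda>j. norm (c j)) {..<n} \<le> sqrt (\<Sum>j<N. (norm (c j))\<^sup>2)"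
    unfolding L2_set_def using n by (intro real_sqrt_le_mono sum_mono2) auto
  also have "\<dots> = sqrt (real N) * L2_set (\<lambda>i. norm (x i)) {..<m}"
    by (simp add: c L2_set_def real_sqrt_mult)
  finally show ?thesis by (simp add: mult_right_mono)
qed

section \<open>Complex interpolation between l_1 and l_2\<close>

text \<open>Hadamard's three lines theorem: dividing by \<open>1 + \<epsilon> z\<close> makes a bounded function
  small on the far horizontal sides of a rectangle, where the maximum principle applies.\<close>

lemma three_lines:
  fixes f :: "complex \<Rightarrow> complex"
  assumes hol: "f holomorphic_on UNIV"
    and bdd: "\<And>z. 0 \<le> Re z \<Longrightarrow> Re z \<le> 1 \<Longrightarrow> norm (f z) \<le> M"
    and edge: "\<And>z. Re z = 0 \<or> Re z = 1 \<Longrightarrow> norm (f z) \<le> 1"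
    and z: "0 \<le> Re z" "Re z \<le> 1"
  shows "norm (f z) \<le> 1"
proof (cases "Re z = 0 \<or> Re z = 1")
  case False
  have le: "norm (f z) \<le> norm (1 + of_real e * z)" if e: "e > 0" for e :: real
  proof -
    \<comment> \<open>The first entry puts \<open>z\<close> inside the rectangle; the second gives
      |1 + e w| >= e R >= M on its horizontal sides.\<close>
    define R where "R = max (\<bar>Im z\<bar> + 1) (M / e)"
    define S where "S = box (Complex 0 (-R)) (Complex 1 R)"
    have "M / e \<le> R" by (simp add: R_def)
    moreover have R0: "R > \<bar>Im z\<bar>" "R > 0" by (auto simp: R_def)
    ultimately have R: "R > \<bar>Im z\<bar>" "M \<le> e * R" "R > 0"
      using pos_divide_le_eq[OF e, of M R] by (simp_all add: mult.commute)
    have zS: "z \<in> S" using False z R by (auto simp: S_def in_box_complex_iff)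
    have clo: "closure S = cbox (Complex 0 (-R)) (Complex 1 R)"
      using zS unfolding S_def by (intro closure_box) auto
    \<comment> \<open>This makes the divisor nonzero and of modulus at least 1, so the bound 1 on
      the vertical sides survives the division.\<close>
    have re: "1 \<le> Re (1 + of_real e * w)" if "w \<in> closure S" for w
      using that e by (simp add: clo in_cbox_complex_iff)
    have nz: "1 + of_real e * w \<noteq> 0" if "w \<in> closure S" for w
      using re[OF that] by force
    have h: "(\<lambda>w. f w / (1 + of_real e * w)) holomorphic_on closure S"
      using nz by (intro holomorphic_intros holomorphic_on_subset[OF hol]) auto
    have "norm (f z / (1 + of_real e * z)) \<le> 1"
    proof (rule maximum_modulus_frontier[of "\<lambda>w. f w / (1 + of_real e * w)" S])
      show "(\<lambda>w. f w / (1 + of_real e * w)) holomorphic_on interior S"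
        using h by (rule holomorphic_on_subset) (meson closure_subset interior_subset order_trans)
      show "continuous_on (closure S) (\<lambda>w. f w / (1 + of_real e * w))"
        using h by (rule holomorphic_on_imp_continuous_on)
      show "bounded S" by (simp add: S_def bounded_box)
      show "z \<in> S" by (rule zS)
    next
      fix w assume w: "w \<in> frontier S"
      then have wc: "w \<in> closure S" by (simp add: frontier_def)
      have "norm (f w) \<le> norm (1 + of_real e * w)"
      proof (cases "Re w = 0 \<or> Re w = 1")
        case True
        then show ?thesis
          using edge[of w] re[OF wc] complex_Re_le_cmod[of "1 + of_real e * w"] by linarith
      next
        case False
        have "w \<notin> S" using w by (simp add: frontier_def S_def interior_open open_box)
        then have "\<bar>Im w\<bar> = R" using wc[unfolded clo] False unfolding S_def
            by (auto simp: in_cbox_complex_iff in_box_complex_iff)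
        then have "norm (1 + of_real e * w) \<ge> e * R"
          using abs_Im_le_cmod[of "1 + of_real e * w"] e by (simp add: abs_mult)
        moreover have "norm (f w) \<le> M"
          using wc by (intro bdd) (auto simp: clo in_cbox_complex_iff)
        ultimately show ?thesis using R by linarith
      qed
      then show "norm (f w / (1 + of_real e * w)) \<le> 1"
        using nz[OF wc] by (simp add: norm_divide)
    qed
    then show ?thesis using nz[of z] zS closure_subset[of S] by (auto simp: norm_divide)
  qed
  have "((\<lambda>e. norm (1 + of_real e * z)) \<longlongrightarrow> norm (1 + of_real 0 * z)) (at_right 0)"
    by (intro tendsto_intros)
  then have "((\<lambda>e. norm (1 + of_real e * z)) \<longlongrightarrow> 1) (at_right 0)" by simp
  then show ?thesis
    by (rule tendsto_lowerbound) (auto intro!: le eventually_at_rightI[of 0 1])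
qed (use edge in blast)

text \<open>The analytic family through \<open>x\<close> of the Riesz--Thorin argument.\<close>

definition powcurve :: "real \<Rightarrow> complex \<Rightarrow> complex \<Rightarrow> complex" where
  "powcurve p x z = (if x = 0 then 0
     else sgn x * exp (of_real (p * ln (norm x)) * (1 - z / 2)))"

text \<open>The exponent is p on Re z = 0 and p/2 on Re z = 1, so a vector in the l_p ball is
  carried into the l_1 ball and the l_2 ball respectively.\<close>

lemma norm_powcurve: "norm (powcurve p x z) = norm x powr (p * (1 - Re z / 2))"
  by (simp add: powcurve_def norm_mult norm_sgn powr_def mult_ac)

text \<open>The parameter solves p (1 - z/2) = 1, that is, 1/p = (1 - z)/1 + z/2.\<close>

lemma powcurve_base:
  assumes "p \<noteq> 0"
  shows "powcurve p x (of_real (2 - 2 / p)) = x"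
proof -
  have "of_real (p * ln (norm x)) * (1 - of_real (2 - 2 / p) / 2)
      = complex_of_real (p * ln (norm x) * (1 - (2 - 2 / p) / 2))"
    by simp
  also have "p * ln (norm x) * (1 - (2 - 2 / p) / 2) = ln (norm x)"
    using assms by (simp add: field_simps)
  finally show ?thesis
    by (simp add: powcurve_def exp_of_real sgn_eq del: of_real_mult)
qed

lemma holomorphic_on_powcurve [holomorphic_intros]: "powcurve p x holomorphic_on S"
  unfolding powcurve_def[abs_def] by (cases "x = 0") (auto intro!: holomorphic_intros)

lemma powr_sum_le_imp_le_1:
  fixes t :: "nat \<Rightarrow> real"
  assumes "(\<Sum>i<n. t i powr p) \<le> 1" "0 < p" "i < n" "0 \<le> t i"
  shows "t i \<le> 1"
proof -
  have "t i powr p \<le> (\<Sum>i<n. t i powr p)"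
    using assms by (intro member_le_sum) auto
  then have "t i powr p \<le> 1 powr p" using assms by simp
  then show ?thesis using assms by (meson linorder_not_le powr_less_mono2 zero_le_one)
qed

text \<open>Riesz--Thorin interpolation between the bound \<open>1\<close> on \<open>\<ell>\<^sub>1 \<times> \<ell>\<^sub>1\<close> and the bound
  \<open>\<surd>N\<close> on \<open>\<ell>\<^sub>2 \<times> \<ell>\<^sub>2\<close>.\<close>

lemma hadamard_bilinear_interpolated:
  fixes x y :: "nat \<Rightarrow> complex"
  assumes H: "hadamard N H" and n: "m \<le> N" "n \<le> N" and p: "1 \<le> p" "p \<le> 2"
    and x: "(\<Sum>i<m. norm (x i) powr p) \<le> 1" and y: "(\<Sum>j<n. norm (y j) powr p) \<le> 1"
  shows "norm (\<Sum>i<m. \<Sum>j<n. of_int (H i j) * x i * y j) \<le> real N powr (1 - 1 / p)"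
proof (cases "N = 0")
  case False
  then have N: "N \<ge> 1" by simp
  define B where "B = (\<lambda>z. \<Sum>i<m. \<Sum>j<n. of_int (H i j) * powcurve p (x i) z * powcurve p (y j) z)"
  \<comment> \<open>The factor is N^(-z/2): modulus 1 on Re z = 0 and 1/sqrt N on Re z = 1, which
    normalizes both edge bounds to 1.\<close>
  define f where "f = (\<lambda>z. B z * exp (- of_real (ln (real N) / 2) * z))"
  have normf: "norm (f z) = norm (B z) * real N powr (- Re z / 2)" for z
    using N by (simp add: f_def norm_mult powr_def mult_ac)
  have sgnH: "\<bar>real_of_int (H i j)\<bar> = 1" if "i < m" "j < n" for i j
  proof -
    have "H i j \<in> {-1, 1}" using H n that by (simp add: hadamard_def)
    then show ?thesis by auto
  qed
  have tri: "norm (B z) \<le> (\<Sum>i<m. \<Sum>j<n. norm (powcurve p (x i) z) * norm (powcurve p (y j) z))" for z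
    unfolding B_def by (intro sum_norm_le) (auto simp: norm_mult sgnH)
  have le1: "norm (x i) \<le> 1" if "i < m" for i
    using powr_sum_le_imp_le_1[OF x] that p by simp
  have le1': "norm (y j) \<le> 1" if "j < n" for j
    using powr_sum_le_imp_le_1[OF y] that p by simp
  define \<theta> where "\<theta> = 2 - 2 / p"
  have "norm (f (of_real \<theta>)) \<le> 1"
  proof (rule three_lines[of f "real m * real n" "of_real \<theta>"])
    show "f holomorphic_on UNIV"
      unfolding f_def B_def by (intro holomorphic_intros)
  next
    fix z assume z: "0 \<le> Re z" "Re z \<le> 1"
    \<comment> \<open>A crude bound suffices inside the strip: all coordinates have modulus at most
      1 and the exponent is nonnegative, so each summand is at most 1.\<close>
    have "norm (B z) \<le> (\<Sum>i<m. \<Sum>j<n. 1)"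
      using z p by (intro order_trans[OF tri] sum_mono mult_le_one)
        (auto simp: norm_powcurve intro!: powr_le1 le1 le1' mult_nonneg_nonneg)
    moreover have "real N powr (- Re z / 2) \<le> 1"
      using z N powr_mono[of "- Re z / 2" 0 "real N"] by simp
    ultimately have "norm (B z) * real N powr (- Re z / 2) \<le> (\<Sum>i<m. \<Sum>j<n. 1) * 1"
      by (intro mult_mono) (auto simp: sum_nonneg)
    then show "norm (f z) \<le> real m * real n" by (simp add: normf)
  next
    fix z assume "Re z = 0 \<or> Re z = 1"
    then show "norm (f z) \<le> 1"
    proof
      assume z: "Re z = 0"
      have "norm (B z) \<le> (\<Sum>i<m. norm (x i) powr p) * (\<Sum>j<n. norm (y j) powr p)"
        using tri[of z] by (simp add: norm_powcurve z sum_product)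
      also have "\<dots> \<le> 1 * 1" using x y by (intro mult_mono) (auto simp: sum_nonneg)
      finally show ?thesis using N by (simp add: normf z)
    next
      assume z: "Re z = 1"
      have sq: "(norm w powr (p / 2))\<^sup>2 = norm w powr p" for w :: complex
        by (simp add: power2_eq_square powr_add[symmetric])
      have "norm (B z) \<le> sqrt (real N) * L2_set (\<lambda>i. norm (powcurve p (x i) z)) {..<m}
          * L2_set (\<lambda>j. norm (powcurve p (y j) z)) {..<n}"
        unfolding B_def by (rule hadamard_bilinear_L2[OF H n])
      also have "\<dots> = sqrt (real N) * (sqrt (\<Sum>i<m. norm (x i) powr p) * sqrt (\<Sum>j<n. norm (y j) powr p))"
        by (simp add: L2_set_def norm_powcurve z sq)
      also have "\<dots> \<le> sqrt (real N) * (1 * 1)"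
        using x y by (intro mult_mono) (auto simp: sum_nonneg)
      finally show ?thesis
        using N by (simp add: normf z powr_minus powr_half_sqrt field_simps)
    qed
  qed (use p in \<open>auto simp: \<theta>_def field_simps\<close>)
  then have "norm (B (of_real \<theta>)) \<le> real N powr (\<theta> / 2)"
    using N by (simp add: normf powr_minus field_simps)
  moreover have "B (of_real \<theta>) = (\<Sum>i<m. \<Sum>j<n. of_int (H i j) * x i * y j)"
    using p by (simp add: B_def \<theta>_def powcurve_base del: of_real_diff)
  moreover have "\<theta> / 2 = 1 - 1 / p" by (simp add: \<theta>_def)
  ultimately show ?thesis by (simp only:)
qed (use n in simp)

section \<open>Unit balls of l_p measured in l_2\<close>

text \<open>Hoelder's inequality with exponent p/2 against the constant vector 1, proved by summing
  Young's inequality over the coordinates.\<close>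

lemma sum_squares_le_of_powr:
  fixes t :: "nat \<Rightarrow> real"
  assumes t: "\<And>i. i < n \<Longrightarrow> 0 \<le> t i" and p: "2 \<le> p" and s: "(\<Sum>i<n. t i powr p) \<le> 1" and n: "1 \<le> n"
  shows "(\<Sum>i<n. (t i)\<^sup>2) \<le> real n powr (1 - 2 / p)"
proof -
  have "(t i)\<^sup>2 \<le> 2 / p * (t i powr p * real n powr (1 - 2 / p)) + (1 - 2 / p) * real n powr (- 2 / p)"
    if "i < n" for i
  proof (cases "t i = 0")
    case False
    then have pos: "t i > 0" using t[OF that] by simp
    \<comment> \<open>The value 1/n is that of each t^p in the extremal case of a constant vector;
      multiplying by n^(1 - 2/p) then removes it from the left side.\<close>
    have "(t i powr p) powr (2 / p) * (1 / real n) powr (1 - 2 / p)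
        \<le> 2 / p * t i powr p + (1 - 2 / p) * (1 / real n)"
      using p n pos by (intro Youngs_inequality_0) auto
    then have "(t i powr p) powr (2 / p) * (1 / real n) powr (1 - 2 / p) * real n powr (1 - 2 / p)
        \<le> (2 / p * t i powr p + (1 - 2 / p) * (1 / real n)) * real n powr (1 - 2 / p)"
      by (rule mult_right_mono) simp
    also have "\<dots> = 2 / p * (t i powr p * real n powr (1 - 2 / p))
        + (1 - 2 / p) * (1 / real n * real n powr (1 - 2 / p))"
      by (simp only: distrib_right mult.assoc)
    also have "1 / real n * real n powr (1 - 2 / p) = real n powr (- 2 / p)"
      using n by (simp add: powr_diff powr_minus field_simps)
    also have "(t i powr p) powr (2 / p) * (1 / real n) powr (1 - 2 / p) * real n powr (1 - 2 / p)
        = (t i powr p) powr (2 / p) * ((1 / real n) powr (1 - 2 / p) * real n powr (1 - 2 / p))"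
      by (simp only: mult.assoc)
    also have "(1 / real n) powr (1 - 2 / p) * real n powr (1 - 2 / p) = 1"
      using n by (simp add: powr_mult[symmetric])
    also have "(t i powr p) powr (2 / p) = (t i)\<^sup>2"
      using p pos by (simp add: powr_powr powr_numeral)
    finally show ?thesis by simp
  qed (use p in auto)
  then have "(\<Sum>i<n. (t i)\<^sup>2) \<le>
      (\<Sum>i<n. 2 / p * (t i powr p * real n powr (1 - 2 / p)) + (1 - 2 / p) * real n powr (- 2 / p))"
    by (intro sum_mono) auto
  also have "\<dots> = 2 / p * ((\<Sum>i<n. t i powr p) * real n powr (1 - 2 / p))
      + (1 - 2 / p) * (real n * real n powr (- 2 / p))"
    by (simp add: sum.distrib sum_distrib_left sum_distrib_right)
  also have "\<dots> \<le> 2 / p * (1 * real n powr (1 - 2 / p)) + (1 - 2 / p) * (real n * real n powr (- 2 / p))"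
    using s p by (intro add_mono mult_left_mono mult_right_mono) auto
  also have "real n * real n powr (- 2 / p) = real n powr (1 - 2 / p)"
    using n by (simp add: powr_diff powr_minus field_simps)
  finally show ?thesis by (simp add: algebra_simps)
qed

text \<open>Coordinates in the unit ball are at most 1, so a larger exponent only shrinks their
  powers.\<close>

lemma lp_ball_powr_sum:
  assumes "x \<in> lp_ball K (ereal r) n" "1 \<le> r" "r \<le> q"
  shows "(\<Sum>i<n. norm (x i) powr q) \<le> 1"
proof -
  have "(\<Sum>i<n. norm (x i) powr r) powr (1 / r) \<le> 1"
    using assms by (simp add: lp_ball_def lp_norm_def)
  then have "((\<Sum>i<n. norm (x i) powr r) powr (1 / r)) powr r \<le> 1"
    using assms(2) by (intro powr_le1) auto
  then have r: "(\<Sum>i<n. norm (x i) powr r) \<le> 1"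
    using assms(2) by (simp add: powr_powr sum_nonneg)
  have "(\<Sum>i<n. norm (x i) powr q) \<le> (\<Sum>i<n. norm (x i) powr r)"
    using assms(2,3) powr_sum_le_imp_le_1[OF r] by (intro sum_mono powr_mono') auto
  with r show ?thesis by simp
qed

text \<open>Replacing a finite exponent r by q = max r 2 treats both ranges at once: for r < 2 the
  ball is included in that of l_2 and the power of n is 0.\<close>

lemma lp_ball_L2_set:
  assumes x: "x \<in> lp_ball K p n" and p: "1 \<le> p" and n: "1 \<le> n"
  shows "L2_set (\<lambda>i. norm (x i)) {..<n} \<le> real n powr max (1/2 - recip p) 0"
proof (cases p)
  case (real r)
  then have r: "1 \<le> r" using p by (simp add: one_ereal_def)
  then have rec: "recip p = 1 / r" using real by (simp add: recip_def one_ereal_def)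
  define q where "q = max r 2"
  have "(\<Sum>i<n. norm (x i) powr q) \<le> 1"
    using lp_ball_powr_sum x real r by (simp add: q_def)
  then have "(\<Sum>i<n. (norm (x i))\<^sup>2) \<le> real n powr (1 - 2 / q)"
    using n by (intro sum_squares_le_of_powr) (auto simp: q_def)
  then have "L2_set (\<lambda>i. norm (x i)) {..<n} \<le> sqrt (real n powr (1 - 2 / q))"
    by (simp add: L2_set_def)
  also have "\<dots> = real n powr ((1 - 2 / q) / 2)"
    by (simp add: powr_half_sqrt[symmetric] powr_powr)
  also have "(1 - 2 / q) / 2 = max (1/2 - recip p) 0"
    using r by (auto simp: q_def rec max_def field_simps)
  finally show ?thesis .
next
  case PInf
  have "norm (x i) \<le> 1" if "i < n" for i
    using norm_le_lp_norm[OF p that, of x] x by (simp add: lp_ball_def)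
  then have "(\<Sum>i<n. (norm (x i))\<^sup>2) \<le> (\<Sum>i<n. 1)"
    by (intro sum_mono) (simp add: power_le_one)
  then have "L2_set (\<lambda>i. norm (x i)) {..<n} \<le> sqrt (real n)"
    by (simp add: L2_set_def)
  then show ?thesis using PInf by (simp add: recip_def powr_half_sqrt)
qed (use p in auto)

section \<open>From norm bounds to the best constant\<close>

lemma recip_conj_exp:
  assumes "1 \<le> p"
  shows "recip (conj_exp p) = 1 - recip p"
proof (cases p)
  case (real r)
  then have "1 \<le> r" using assms by (simp add: one_ereal_def)
  \<comment> \<open>For r = 1 the conjugate exponent is 1/0, which is infinity in
    \<open>ereal\<close>, and both sides are 0.\<close>
  then show ?thesis using real
    by (cases "r = 1") (auto simp: recip_def conj_exp_def one_ereal_def divide_ereal_def zero_ereal_def inverse_eq_divide)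
next
  case PInf
  then show ?thesis by (simp add: recip_def conj_exp_def)
qed (use assms in auto)

lemma zero_in_lp_ball:
  assumes "0 \<in> K" "1 \<le> p" "1 \<le> n"
  shows "(\<lambda>i\<in>{..<n}. 0) \<in> lp_ball K p n"
proof -
  have "(\<lambda>i. norm ((\<lambda>i\<in>{..<n}. 0 :: complex) i)) ` {..<n} = {0}"
    using assms(3) by (auto simp: image_iff intro!: exI[of _ 0])
  then show ?thesis using assms by (auto simp: lp_ball_def lp_norm_def)
qed

text \<open>The upper left corner of \<open>H\<close> supplies the sign form;
  \<open>0 \<in> K\<close> makes the balls nonempty, so a pointwise bound passes to the
  supremum.\<close>

lemma best_const_le_of_hadamard:
  assumes K: "0 \<in> K" and p: "1 \<le> p1" "1 \<le> p2" and n: "1 \<le> n1" "1 \<le> n2" and C: "0 \<le> C"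
    and H: "hadamard N H" "n1 \<le> N" "n2 \<le> N"
    and bound: "\<And>x y. x \<in> lp_ball K p1 n1 \<Longrightarrow> y \<in> lp_ball K p2 n2 \<Longrightarrow>
      norm (\<Sum>i<n1. \<Sum>j<n2. of_int (H i j) * x i * y j) \<le> C * growth p1 p2 n1 n2"
  shows "best_const K p1 p2 n1 n2 \<le> C"
proof (rule admissible_best_const(2)[OF n])
  define A :: form where "A = (\<lambda>x y. \<Sum>i<n1. \<Sum>j<n2. of_int (H i j) * x i * y j)"
  have "\<forall>i<n1. \<forall>j<n2. (of_int (H i j) :: complex) \<in> {-1, 1}"
  proof (intro allI impI)
    fix i j assume "i < n1" "j < n2"
    then have "H i j \<in> {-1, 1}" using H by (simp add: hadamard_def)
    then show "(of_int (H i j) :: complex) \<in> {-1, 1}" by auto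
  qed
  then have "A \<in> sign_forms n1 n2"
    unfolding sign_forms_def A_def by (intro CollectI exI[of _ "\<lambda>i j. of_int (H i j)"]) auto
  moreover have "form_norm K p1 p2 n1 n2 A \<le> C * growth p1 p2 n1 n2"
    unfolding form_norm_def
  proof (rule cSUP_least)
    show "lp_ball K p1 n1 \<times> lp_ball K p2 n2 \<noteq> {}"
      using zero_in_lp_ball[OF K] p n by blast
  qed (auto simp: A_def intro: bound)
  ultimately show "admissible K p1 p2 n1 n2 C" using C by (auto simp: admissible_def)
qed

text \<open>The premise on \<open>growth\<close> is the l_2 estimate for an ideal matrix of order
  max n1 n2; the true order costs sqrt(N / max n1 n2) <= sqrt(8/5).\<close>

lemma best_const_le_L2:
  assumes K: "0 \<in> K" and p: "1 \<le> p1" "1 \<le> p2" and n: "1 \<le> n1" "1 \<le> n2"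
    and g: "sqrt (real (max n1 n2)) * real n1 powr max (1/2 - recip p1) 0
      * real n2 powr max (1/2 - recip p2) 0 \<le> growth p1 p2 n1 n2"
  shows "best_const K p1 p2 n1 n2 \<le> sqrt (8/5)"
proof -
  obtain N H where H: "hadamard N H" "max n1 n2 \<le> N" and N: "5 * N \<le> 8 * max n1 n2"
    by (rule exists_hadamard[of "max n1 n2"]) (use n in auto)
  let ?e1 = "real n1 powr max (1/2 - recip p1) 0" and ?e2 = "real n2 powr max (1/2 - recip p2) 0"
  have "real N \<le> 8 / 5 * real (max n1 n2)" using N by linarith
  then have N': "sqrt (real N) \<le> sqrt (8 / 5) * sqrt (real (max n1 n2))"
    by (simp only: real_sqrt_mult[symmetric] real_sqrt_le_iff)
  show ?thesis
  proof (rule best_const_le_of_hadamard[OF K p n _ H(1)])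
    fix x y assume x: "x \<in> lp_ball K p1 n1" and y: "y \<in> lp_ball K p2 n2"
    have "norm (\<Sum>i<n1. \<Sum>j<n2. of_int (H i j) * x i * y j)
        \<le> sqrt (real N) * L2_set (\<lambda>i. norm (x i)) {..<n1} * L2_set (\<lambda>j. norm (y j)) {..<n2}"
      using H by (intro hadamard_bilinear_L2) auto
    also have "\<dots> \<le> (sqrt (8 / 5) * sqrt (real (max n1 n2))) * ?e1 * ?e2"
      using lp_ball_L2_set[OF x p(1) n(1)] lp_ball_L2_set[OF y p(2) n(2)] N'
      by (intro mult_mono) (auto intro!: mult_nonneg_nonneg)
    also have "\<dots> \<le> sqrt (8 / 5) * growth p1 p2 n1 n2"
      using mult_left_mono[OF g, of "sqrt (8 / 5)"] by (simp add: mult_ac)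
    finally show "norm (\<Sum>i<n1. \<Sum>j<n2. of_int (H i j) * x i * y j)
      \<le> sqrt (8 / 5) * growth p1 p2 n1 n2" .
  qed (use H in auto)
qed

text \<open>Both balls lie in the l_q ball, and the excess order costs (8/5)^(1 - 1/q), where 1 -
  1/q <= 1/2.\<close>

lemma best_const_le_interpolated:
  assumes K: "0 \<in> K" and p: "1 \<le> p1" "1 \<le> p2" and n: "1 \<le> n1" "1 \<le> n2"
    and q: "p1 \<le> ereal q" "p2 \<le> ereal q" "q \<le> 2"
    and g: "real (max n1 n2) powr (1 - 1 / q) \<le> growth p1 p2 n1 n2"
  shows "best_const K p1 p2 n1 n2 \<le> sqrt (8/5)"
proof -
  obtain N H where H: "hadamard N H" "max n1 n2 \<le> N" and N: "5 * N \<le> 8 * max n1 n2"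
    by (rule exists_hadamard[of "max n1 n2"]) (use n in auto)
  obtain r1 r2 where r: "p1 = ereal r1" "p2 = ereal r2"
    using p q by (cases p1; cases p2) auto
  have r1: "1 \<le> r1" "1 \<le> r2" "r1 \<le> q" "r2 \<le> q" using p q r by (auto simp: one_ereal_def)
  then have q1: "1 \<le> q" by simp
  show ?thesis
  proof (rule best_const_le_of_hadamard[OF K p n _ H(1)])
    fix x y assume "x \<in> lp_ball K p1 n1" and "y \<in> lp_ball K p2 n2"
    then have "norm (\<Sum>i<n1. \<Sum>j<n2. of_int (H i j) * x i * y j) \<le> real N powr (1 - 1 / q)"
      using H q q1 r r1 by (intro hadamard_bilinear_interpolated) (auto intro: lp_ball_powr_sum)
    also have "\<dots> \<le> (8 / 5 * real (max n1 n2)) powr (1 - 1 / q)"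
      using N q1 by (intro powr_mono2) auto
    also have "\<dots> = (8 / 5) powr (1 - 1 / q) * real (max n1 n2) powr (1 - 1 / q)"
      by (rule powr_mult)
    also have "\<dots> \<le> (8 / 5) powr (1 / 2) * growth p1 p2 n1 n2"
      using g q q1 by (intro mult_mono powr_mono) (auto simp: field_simps)
    also have "\<dots> = sqrt (8 / 5) * growth p1 p2 n1 n2"
      by (simp add: powr_half_sqrt)
    finally show "norm (\<Sum>i<n1. \<Sum>j<n2. of_int (H i j) * x i * y j)
      \<le> sqrt (8 / 5) * growth p1 p2 n1 n2" .
  qed (use H in auto)
qed

section \<open>Comparison with the growth term in each range of exponents\<close>

lemma recip_mono:
  assumes "1 \<le> p" "p \<le> q"
  shows "recip q \<le> recip p"
  using assms by (cases p; cases q) (auto simp: recip_def one_ereal_def frac_le)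

lemma one_le_two_ereal: "(1 :: ereal) \<le> 2"
  by (simp add: one_ereal_def numeral_eq_ereal)

lemma sqrt_mult_powr:
  fixes a :: real
  assumes "0 \<le> a"
  shows "sqrt a * a powr (1 / 2 - c) = a powr (1 - c)"
  using assms by (simp add: powr_half_sqrt[symmetric] powr_add[symmetric])

lemma recip_2: "recip 2 = 1 / 2"
  by (simp add: recip_def one_ereal_def numeral_eq_ereal)

text \<open>The square root of the larger dimension n merges with its own power: n^(1/2) n^(1/2 -
  1/p) = n^(1 - 1/p), giving one of the two terms of \<open>growth\<close>.\<close>

lemma best_const_le_ge_2:
  assumes K: "0 \<in> K" and p: "2 \<le> p1" "2 \<le> p2" and n: "1 \<le> n1" "1 \<le> n2"
  shows "best_const K p1 p2 n1 n2 \<le> sqrt (8/5)"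
proof (rule best_const_le_L2[OF K _ _ n])
  show p': "1 \<le> p1" "1 \<le> p2" using one_le_two_ereal p order_trans by blast+
  have r: "recip p1 \<le> 1 / 2" "recip p2 \<le> 1 / 2"
    using recip_mono[OF one_le_two_ereal p(1)] recip_mono[OF one_le_two_ereal p(2)] recip_2 by auto
  let ?a = "1 / 2 - recip p1" and ?b = "1 / 2 - recip p2"
  have e: "max ?a 0 = ?a" "max ?b 0 = ?b"
    using r by auto
  show "sqrt (real (max n1 n2)) * real n1 powr max ?a 0 * real n2 powr max ?b 0
      \<le> growth p1 p2 n1 n2"
  proof (cases "n1 \<le> n2")
    case True
    then have "sqrt (real (max n1 n2)) * real n1 powr ?a * real n2 powr ?b
        = sqrt (real n2) * real n2 powr ?b * real n1 powr ?a"
      by (simp add: max_absorb2)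
    also have "\<dots> = real n2 powr (1 - recip p2) * real n1 powr ?a"
      using sqrt_mult_powr[of "real n2" "recip p2"] n by simp
    finally show ?thesis
      unfolding e growth_def recip_conj_exp[OF p'(1)] recip_conj_exp[OF p'(2)]
      by (rule max.coboundedI2[OF eq_refl])
  next
    case False
    then have "sqrt (real (max n1 n2)) * real n1 powr ?a * real n2 powr ?b
        = sqrt (real n1) * real n1 powr ?a * real n2 powr ?b"
      by (simp add: max_absorb1)
    also have "\<dots> = real n1 powr (1 - recip p1) * real n2 powr ?b"
      using sqrt_mult_powr[of "real n1" "recip p1"] n by simp
    finally show ?thesis
      unfolding e growth_def recip_conj_exp[OF p'(1)] recip_conj_exp[OF p'(2)]
      by (rule max.coboundedI1[OF eq_refl])
  qed
qed

text \<open>The exponent at most 2 contributes a zeroth power, and the larger dimension belongs to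
  the exponent at least 2, so the square root merges as before.\<close>

lemma best_const_le_mixed:
  assumes K: "0 \<in> K" and p: "1 \<le> p1" "1 \<le> p2" and n: "1 \<le> n1" "1 \<le> n2"
    and h: "(p1 \<le> 2 \<and> 2 \<le> p2 \<and> n1 \<le> n2) \<or> (p2 \<le> 2 \<and> 2 \<le> p1 \<and> n2 \<le> n1)"
  shows "best_const K p1 p2 n1 n2 \<le> sqrt (8/5)"
proof (rule best_const_le_L2[OF K p n])
  have le: "recip q \<le> 1 / 2" if "2 \<le> q" for q
    using recip_mono[OF one_le_two_ereal that] recip_2 by simp
  have ge: "1 / 2 \<le> recip q" if "1 \<le> q" "q \<le> 2" for q
    using recip_mono[OF that] recip_2 by simp
  from h show "sqrt (real (max n1 n2)) * real n1 powr max (1/2 - recip p1) 0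
      * real n2 powr max (1/2 - recip p2) 0 \<le> growth p1 p2 n1 n2"
  proof (elim disjE conjE)
    assume a: "p1 \<le> 2" "2 \<le> p2" "n1 \<le> n2"
    then show ?thesis
      using sqrt_mult_powr[of "real n2" "recip p2"] n ge[OF p(1)] le[of p2]
      by (simp add: growth_def recip_conj_exp p max_absorb2)
  next
    assume a: "p2 \<le> 2" "2 \<le> p1" "n2 \<le> n1"
    then show ?thesis
      using sqrt_mult_powr[of "real n1" "recip p1"] n ge[OF p(2)] le[of p1]
      by (simp add: growth_def recip_conj_exp p max_absorb1 max_absorb2)
  qed
qed

text \<open>The larger exponent q goes with the larger dimension, so the interpolated bound is
  exactly one of the two terms of \<open>growth\<close>.\<close>

lemma best_const_le_le_2:
  assumes K: "0 \<in> K" and p: "1 \<le> p1" "1 \<le> p2" and n: "1 \<le> n1" "1 \<le> n2"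
    and h: "(p1 \<le> p2 \<and> p2 \<le> 2 \<and> n1 \<le> n2) \<or> (p2 \<le> p1 \<and> p1 \<le> 2 \<and> n2 \<le> n1)"
  shows "best_const K p1 p2 n1 n2 \<le> sqrt (8/5)"
proof -
  have ge: "1 / 2 \<le> recip q" if "1 \<le> q" "q \<le> 2" for q
    using recip_mono[OF that] recip_2 by simp
  define q where "q = max p1 p2"
  have q: "1 \<le> q" "q \<le> 2" "p1 \<le> q" "p2 \<le> q" using p h by (auto simp: q_def)
  obtain r where r: "q = ereal r" using q by (cases q) auto
  have rec: "recip q = 1 / r" using r q by (simp add: recip_def one_ereal_def)
  from h have "real (max n1 n2) powr (1 - recip q) \<le> growth p1 p2 n1 n2"
  proof (elim disjE conjE)
    assume a: "p1 \<le> p2" "p2 \<le> 2" "n1 \<le> n2"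
    then have "p1 \<le> 2" by simp
    with a show ?thesis
      using ge[OF p(1)] ge[OF p(2)] n
      by (simp add: growth_def recip_conj_exp p max_absorb2 q_def)
  next
    assume a: "p2 \<le> p1" "p1 \<le> 2" "n2 \<le> n1"
    then have "p2 \<le> 2" by simp
    with a show ?thesis
      using ge[OF p(1)] ge[OF p(2)] n
      by (simp add: growth_def recip_conj_exp p max_absorb1 max_absorb2 q_def)
  qed
  then show ?thesis
    using q r rec by (intro best_const_le_interpolated[OF K p n, of r]) (auto simp: numeral_eq_ereal)
qed

lemma sup_const_le:
  assumes "\<And>n1 n2. 1 \<le> n1 \<Longrightarrow> 1 \<le> n2 \<Longrightarrow> best_const K p1 p2 n1 n2 \<le> C"
  shows "sup_const K p1 p2 \<le> ereal C"
  unfolding sup_const_def by (rule SUP_least) (use assms in auto)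

theorem theorem3p3:
  fixes K :: "complex set"
  assumes "K = \<real> \<or> K = UNIV"
  shows "(\<forall>p1 p2 :: ereal. 2 \<le> p1 \<longrightarrow> 2 \<le> p2 \<longrightarrow> sup_const K p1 p2 \<le> ereal (sqrt (8/5))) \<and>
    (\<forall>p :: ereal. 1 \<le> p \<longrightarrow> sup_const K p p \<le> ereal (sqrt (8/5))) \<and>
    (\<forall>(p1 :: ereal) (p2 :: ereal) (n1 :: nat) (n2 :: nat).
       1 \<le> p1 \<longrightarrow> 1 \<le> p2 \<longrightarrow> 1 \<le> n1 \<longrightarrow> 1 \<le> n2 \<longrightarrow>
       (1 \<le> p1 \<and> p1 < 2 \<and> 2 \<le> p2 \<and> n1 \<le> n2) \<or>
       (1 \<le> p2 \<and> p2 < 2 \<and> 2 \<le> p1 \<and> n2 \<le> n1) \<or>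
       (1 \<le> p1 \<and> p1 \<le> p2 \<and> p2 \<le> 2 \<and> n1 \<le> n2) \<or>
       (1 \<le> p2 \<and> p2 \<le> p1 \<and> p1 \<le> 2 \<and> n2 \<le> n1) \<longrightarrow>
       best_const K p1 p2 n1 n2 \<le> sqrt (8/5))"
proof (intro conjI allI impI)
  have K: "0 \<in> K" using assms by auto
  show "sup_const K p1 p2 \<le> ereal (sqrt (8/5))" if "2 \<le> p1" "2 \<le> p2" for p1 p2
    using that by (intro sup_const_le best_const_le_ge_2[OF K])
  show "sup_const K p p \<le> ereal (sqrt (8/5))" if "1 \<le> p" for p
  proof (rule sup_const_le)
    fix n1 n2 :: nat assume n: "1 \<le> n1" "1 \<le> n2"
    show "best_const K p p n1 n2 \<le> sqrt (8/5)"
    proof (cases "2 \<le> p")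
      case True
      then show ?thesis using n by (intro best_const_le_ge_2[OF K])
    next
      case False
      \<comment> \<open>With equal exponents, one of the two alternatives holds whichever dimension
        is larger.\<close>
      then show ?thesis using n that by (intro best_const_le_le_2[OF K]) auto
    qed
  qed
  show "best_const K p1 p2 n1 n2 \<le> sqrt (8/5)"
    if "1 \<le> p1" "1 \<le> p2" "1 \<le> n1" "1 \<le> n2"
      "(1 \<le> p1 \<and> p1 < 2 \<and> 2 \<le> p2 \<and> n1 \<le> n2) \<or>
       (1 \<le> p2 \<and> p2 < 2 \<and> 2 \<le> p1 \<and> n2 \<le> n1) \<or>
       (1 \<le> p1 \<and> p1 \<le> p2 \<and> p2 \<le> 2 \<and> n1 \<le> n2) \<or>
       (1 \<le> p2 \<and> p2 \<le> p1 \<and> p1 \<le> 2 \<and> n2 \<le> n1)" for p1 p2 n1 n2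
    using that(5) best_const_le_mixed[OF K that(1-4)] best_const_le_le_2[OF K that(1-4)]
    by (auto simp: less_imp_le)
qed

end
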